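(* The closed topologist's sine curve has the $\mathcal{AF}$-property but does not have enough arcs.
   Context: The closed topologist's sine curve is the closure $\overline{S}$ in $\mathbb{R}^2$ of $S=\{\langle x,\sin\frac1x\rangle : 0<x\le \frac{2}{\pi}\}$, where $\langle a,b\rangle$ denotes the point of $\mathbb{R}^2$ with coordinates $a,b$. For a metrizable space $X$, a continuous map $f\colon X\to X$ and a point $x\in X$, the $\alpha$-limit set of $x$ is $\alpha_f(x)=\bigcap_{n\ge 0}\overline{\bigcup_{k\ge n} f^{-k}(x)}$, where $f^{-k}(x)=\{y\in X: f^k(y)=x\}$. A set $A\subseteq X$ is an $\alpha$-limit set in $X$ if $A=\alpha_f(x)$ for some continuous $f\colon X\to X$ and some $x\in X$. A metrizable space $X$ has the $\mathcal{AF}$-property if the $\alpha$-limit sets in $X$ are precisely the closed subsets of $X$ (including $\emptyset$ and $X$). An arc is a homeomorphic copy of $[0,1]$. A space with enough arcs is a metrizable space $X$ with at least two points such that for every nonempty proper closed subset $A\subseteq X$ there is an arc in $X$ with one endpoint in $A$ and the other endpoint in $X\setminus A$. *)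

theory Defs
  imports "HOL-Analysis.Analysis"
begin

definition alpha_limit :: "'a topology \<Rightarrow> ('a \<Rightarrow> 'a) \<Rightarrow> 'a \<Rightarrow> 'a set" where
  "alpha_limit X f x =
     (\<Inter>n. X closure_of (\<Union>k\<in>{n..}. {y \<in> topspace X. (f ^^ k) y = x}))"

definition alpha_limit_set_in :: "'a topology \<Rightarrow> 'a set \<Rightarrow> bool" where
  "alpha_limit_set_in X A \<longleftrightarrow>
     (\<exists>f x. continuous_map X X f \<and> x \<in> topspace X \<and> A = alpha_limit X f x)"

definition AF_property :: "'a topology \<Rightarrow> bool" where
  "AF_property X \<longleftrightarrow>
     metrizable_space X \<and> (\<forall>A. alpha_limit_set_in X A \<longleftrightarrow> closedin X A)"

text \<open>The library predicate \<^const>\<open>arc\<close> is about paths in a type class topology; here an arc is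
  a set \<open>C\<close> in an abstract topological space, and its endpoints are the images of 0 and 1.\<close>

definition arc_with_endpoints :: "'a topology \<Rightarrow> 'a set \<Rightarrow> 'a \<Rightarrow> 'a \<Rightarrow> bool" where
  "arc_with_endpoints X C a b \<longleftrightarrow>
     C \<subseteq> topspace X \<and>
     (\<exists>h. homeomorphic_map (top_of_set {0..1::real}) (subtopology X C) h \<and> h 0 = a \<and> h 1 = b)"

definition enough_arcs :: "'a topology \<Rightarrow> bool" where
  "enough_arcs X \<longleftrightarrow>
     metrizable_space X \<and>
     (\<exists>x\<in>topspace X. \<exists>y\<in>topspace X. x \<noteq> y) \<and>
     (\<forall>A. closedin X A \<and> A \<noteq> {} \<and> A \<noteq> topspace X \<longrightarrow>
        (\<exists>C. \<exists>a\<in>A. \<exists>b\<in>topspace X - A. arc_with_endpoints X C a b))"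

definition sine_curve :: "(real \<times> real) set" where
  "sine_curve = {(x, sin (1 / x)) | x. 0 < x \<and> x \<le> 2 / pi}"

definition closed_sine_curve :: "(real \<times> real) topology" where
  "closed_sine_curve = top_of_set (closure sine_curve)"

end

theory Submission imports Defs begin

text \<open>
  The closed topologist's sine curve is the union of two path-connected pieces, the limit segment
  \<open>L = {0} \<times> [-1,1]\<close> and the curve \<open>S\<close>, and no path leads from \<open>L\<close> to \<open>S\<close>: approaching \<open>L\<close> along
  \<open>S\<close> forces infinitely many oscillations of the second coordinate
  (\<open>path_from_limit_segment_stays_in_limit_segment\<close>). So the closed set \<open>L\<close> witnesses that there are
  not enough arcs.

  Alpha-limit sets are closed by definition. Conversely, let \<open>A\<close> be closed. The empty set and the
  whole space are alpha-limit sets of constant maps. If a path \<open>\<beta>\<close> meets \<open>A\<close> only in its starting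
  point, then \<open>f = \<beta> \<circ> min 1 (dist(_, A))\<close> sends \<open>A\<close> to \<open>\<beta> 0 \<in> A\<close> and everything else outside \<open>A\<close>,
  so every iterated preimage of \<open>\<beta> 0\<close> is exactly \<open>A\<close>
  (\<open>alpha_limit_set_in_if_separates_path_connected\<close>). Such a path exists as soon as \<open>A\<close> contains some
  but not all points of \<open>L\<close>, or some but not all points of \<open>S\<close>. As \<open>S\<close> is dense, the one remaining
  case is \<open>A = L\<close>.

  For \<open>A = L\<close> the space is moved along \<open>S\<close> away from \<open>L\<close> by \<open>1/x = u \<mapsto> sqrt (u\<^sup>2 - 1)\<close>, stopping at the
  end \<open>x = 2/pi\<close>. The displacement of \<open>u\<close> tends to \<open>0\<close> at \<open>L\<close>, so the map extends continuously by
  the identity on \<open>L\<close>. The iterated preimages of the point with \<open>u = 2\<close> are the single points with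
  \<open>u = sqrt (4 + k)\<close>. They run towards \<open>L\<close> with step length tending to \<open>0\<close> in \<open>u\<close>, hence
  accumulate at all points of \<open>L\<close> and nowhere else (\<open>alpha_limit_slide\<close>).
\<close>

section \<open>Alpha-limit sets in general spaces\<close>

lemma closedin_alpha_limit: "closedin X (alpha_limit X f x)"
  unfolding alpha_limit_def by (intro closedin_Inter) auto

lemma funpow_const: "0 < k \<Longrightarrow> ((\<lambda>_. c) ^^ k) y = c" for c y :: 'a
  by (cases k) auto

lemma alpha_limit_set_in_topspace:
  assumes "topspace X \<noteq> {}"
  shows "alpha_limit_set_in X (topspace X)"
proof -
  obtain c where c: "c \<in> topspace X" using assms by blast
  have "(\<Union>k\<in>{n..}. {y \<in> topspace X. ((\<lambda>_. c) ^^ k) y = c}) = topspace X" for n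
    using funpow_const[of "Suc n"] by (auto intro!: bexI[of _ "Suc n"] simp del: funpow.simps)
  then have "topspace X = alpha_limit X (\<lambda>_. c) c"
    unfolding alpha_limit_def by simp
  then show ?thesis unfolding alpha_limit_set_in_def using c
    by (intro exI[of _ "\<lambda>_. c"] exI[of _ c]) auto
qed

lemma alpha_limit_set_in_empty:
  assumes "c \<in> topspace X" "d \<in> topspace X" "c \<noteq> d"
  shows "alpha_limit_set_in X {}"
proof -
  have "(\<Union>k\<in>{1..}. {y \<in> topspace X. ((\<lambda>_. c) ^^ k) y = d}) = {}"
    using funpow_const[of _ c] \<open>c \<noteq> d\<close> by fastforce
  then have "X closure_of (\<Union>k\<in>{1..}. {y \<in> topspace X. ((\<lambda>_. c) ^^ k) y = d}) = {}"
    by (simp only: closure_of_empty)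
  then have "alpha_limit X (\<lambda>_. c) d = {}"
    unfolding alpha_limit_def by blast
  then show ?thesis unfolding alpha_limit_set_in_def using assms
    by (intro exI[of _ "\<lambda>_. c"] exI[of _ d]) auto
qed

text \<open>Cutting off everything before the last visit to \<open>A\<close> leaves a path that meets \<open>A\<close> at time
  \<open>0\<close> only; the last visit exists because the visiting times form a compact set.\<close>

lemma path_from_last_visit:
  fixes \<gamma> :: "real \<Rightarrow> 'a::metric_space"
  assumes \<gamma>: "continuous_on {0..1} \<gamma>" "\<gamma> ` {0..1} \<subseteq> X"
    and A: "closedin (top_of_set X) A" "\<gamma> 0 \<in> A" "\<gamma> 1 \<notin> A"
  obtains \<beta> :: "real \<Rightarrow> 'a" where "continuous_on {0..1} \<beta>" "\<beta> ` {0..1} \<subseteq> X"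
    "\<And>t. t \<in> {0..1} \<Longrightarrow> \<beta> t \<in> A \<longleftrightarrow> t = 0"
proof -
  let ?V = "{0..1} \<inter> \<gamma> -` A"
  have "closedin (top_of_set {0..1}) ?V"
    using \<gamma> by (intro continuous_closedin_preimage_gen[OF _ _ A(1)]) auto
  then have "compact ?V" by (rule closedin_compact[rotated]) simp
  moreover have "0 \<in> ?V" using A by simp
  ultimately obtain s where s: "s \<in> ?V" and last: "\<And>t. t \<in> ?V \<Longrightarrow> t \<le> s"
    by (metis compact_attains_sup empty_iff)
  then have s01: "0 \<le> s" "s < 1" using A by (auto simp: order_less_le)
  define \<beta> where "\<beta> = (\<lambda>t. \<gamma> (s + (1 - s) * t))"
  have range: "s + (1 - s) * t \<in> {0..1}" if "t \<in> {0..1}" for t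
  proof -
    have "(1 - s) * t \<le> 1 - s" "0 \<le> (1 - s) * t"
      using that s01 by (auto intro: mult_left_le)
    then show ?thesis unfolding atLeastAtMost_iff using s01 by linarith
  qed
  show thesis
  proof (rule that[of \<beta>])
    show "continuous_on {0..1} \<beta>" unfolding \<beta>_def
      by (rule continuous_on_compose2[OF \<gamma>(1)]) (use range in \<open>auto intro!: continuous_intros\<close>)
    show "\<beta> ` {0..1} \<subseteq> X" using range \<gamma>(2) by (auto simp: \<beta>_def)
    show "\<beta> t \<in> A \<longleftrightarrow> t = 0" if "t \<in> {0..1}" for t
    proof
      assume "\<beta> t \<in> A"
      then have "s + (1 - s) * t \<le> s" using last[of "s + (1 - s) * t"] range[OF that] unfolding \<beta>_def by blast
      then have "(1 - s) * t \<le> 0" by simp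
      then show "t = 0" using s01 that by (simp add: mult_le_0_iff)
    qed (use s in \<open>simp add: \<beta>_def\<close>)
  qed
qed

text \<open>A space that is not itself path-connected is covered as well: one path-connected subset
  that \<open>A\<close> cuts into two nonempty parts supplies the path \<open>\<beta>\<close> that is needed. The map
  \<open>\<beta> \<circ> min 1 (infdist _ A)\<close> then has \<open>A\<close> as the fibre over \<open>\<beta> 0\<close> and as the preimage of \<open>A\<close>.\<close>

lemma alpha_limit_set_in_if_separates_path_connected:
  fixes X :: "'a::metric_space set"
  assumes A: "closedin (top_of_set X) A"
    and P: "path_connected P" "P \<subseteq> X" "P \<inter> A \<noteq> {}" "P - A \<noteq> {}"
  shows "alpha_limit_set_in (top_of_set X) A"
proof -
  from P(3,4) obtain a b where "a \<in> P" "a \<in> A" "b \<in> P" "b \<notin> A" by blast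
  with P(1) obtain \<gamma> where "path \<gamma>" "path_image \<gamma> \<subseteq> P" "\<gamma> 0 = a" "\<gamma> 1 = b"
    unfolding path_connected_def pathstart_def pathfinish_def by metis
  with P(2) have "continuous_on {0..1} \<gamma>" "\<gamma> ` {0..1} \<subseteq> X" "\<gamma> 0 \<in> A" "\<gamma> 1 \<notin> A"
    using \<open>a \<in> A\<close> \<open>b \<notin> A\<close> by (auto simp: path_def path_image_def)
  then obtain \<beta> :: "real \<Rightarrow> 'a" where \<beta>: "continuous_on {0..1} \<beta>" "\<beta> ` {0..1} \<subseteq> X"
    and start: "\<And>t. t \<in> {0..1} \<Longrightarrow> \<beta> t \<in> A \<longleftrightarrow> t = 0"
    using path_from_last_visit[OF _ _ A] by metis
  have AX: "A \<subseteq> X" using A closedin_imp_subset by blast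
  have A_eq: "A = X \<inter> closure A"
    using A AX closure_of_eq[of "top_of_set X" A]
    by (simp add: closure_of_subtopology Int_absorb1)
  define g where "g = (\<lambda>y. min 1 (infdist y A))"
  have g_range: "g y \<in> {0..1}" for y by (auto simp: g_def infdist_nonneg)
  have g_0: "g y = 0 \<longleftrightarrow> y \<in> A" if "y \<in> X" for y
    using that A_eq in_closure_iff_infdist_zero[of A y] \<open>a \<in> A\<close>
    by (auto simp: g_def min_def split: if_splits)
  define f where "f = (\<lambda>y. \<beta> (g y))"
  have f_X: "f y \<in> X" for y using g_range[of y] \<beta>(2) by (auto simp: f_def)
  have f_A: "f y \<in> A \<longleftrightarrow> y \<in> A" if "y \<in> X" for y
    using start[OF g_range] g_0[OF that] by (simp add: f_def)
  have f_on_A: "f y = \<beta> 0" if "y \<in> A" for y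
  proof -
    have "g y = 0" using g_0[of y] that AX by blast
    then show ?thesis by (simp add: f_def)
  qed
  have b0: "\<beta> 0 \<in> A" using start[of 0] by simp
  have iter: "(f ^^ Suc k) y = \<beta> 0 \<longleftrightarrow> y \<in> A" if "y \<in> X" for k y
    using that
  proof (induction k arbitrary: y)
    case 0
    then show ?case using f_on_A[of y] b0 f_A[of y] by auto
  next
    case (Suc k)
    then show ?case using Suc.IH[OF f_X] f_A by (simp add: funpow_Suc_right del: funpow.simps)
  qed
  have "(\<Union>k\<in>{n..}. {y \<in> topspace (top_of_set X). (f ^^ k) y = \<beta> 0}) = A" (is "?U = A") for n
  proof
    \<comment> \<open>The level \<open>k = 0\<close> adds only the point \<open>\<beta> 0\<close> itself, which lies in \<open>A\<close>.\<close>
    show "?U \<subseteq> A"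
    proof clarsimp
      fix k y assume "y \<in> X" "(f ^^ k) y = \<beta> 0"
      then show "y \<in> A" using b0 iter by (cases k) auto
    qed
    show "A \<subseteq> ?U"
    proof
      fix y assume "y \<in> A"
      then have "y \<in> X" "(f ^^ Suc n) y = \<beta> 0" using iter[of y n] AX by auto
      then show "y \<in> ?U" by (auto intro!: bexI[of _ "Suc n"] simp del: funpow.simps)
    qed
  qed
  then have "A = alpha_limit (top_of_set X) f (\<beta> 0)"
    using closure_of_eq[of "top_of_set X" A] A unfolding alpha_limit_def by simp
  moreover have "continuous_map (top_of_set X) (top_of_set X) f"
  proof -
    have "continuous_on X f" unfolding f_def g_def
      by (rule continuous_on_compose2[OF \<beta>(1)])
        (use g_range in \<open>auto simp: g_def intro!: continuous_intros\<close>)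
    then show ?thesis using f_X by auto
  qed
  ultimately show ?thesis using b0 AX unfolding alpha_limit_set_in_def by auto
qed

section \<open>Shape of the closed topologist's sine curve\<close>

definition limit_segment :: "(real \<times> real) set" where
  "limit_segment = {0} \<times> {-1..1}"

text \<open>The parameters \<open>sqrt (4 + k)\<close> tend to infinity with gaps tending to \<open>0\<close>, so their sines are
  dense in \<open>[-1,1]\<close>. The offset \<open>4\<close> makes all of them larger than \<open>pi / 2\<close>, the parameter of the
  endpoint of the curve.\<close>

definition sqrt_point :: "nat \<Rightarrow> real \<times> real" where
  "sqrt_point k = (1 / sqrt (4 + real k), sin (sqrt (4 + real k)))"

lemma inverse_sqrt_less_two_div_pi: "1 / sqrt (4 + real k) < 2 / pi"
proof -
  have "sqrt 4 \<le> sqrt (4 + real k)" by (intro real_sqrt_le_mono) simp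
  then have "1 / sqrt (4 + real k) \<le> 1 / 2" by (intro divide_left_mono) auto
  also have "1 / 2 < 2 / pi" using pi_less_4 by (simp add: field_simps)
  finally show ?thesis .
qed

lemma sqrt_point_in_sine_curve: "sqrt_point k \<in> sine_curve"
  unfolding sine_curve_def sqrt_point_def
  using inverse_sqrt_less_two_div_pi[of k]
  by (auto intro!: exI[of _ "1 / sqrt (4 + real k)"])

lemma sin_eq_beyond:
  fixes y M :: real
  assumes "\<bar>y\<bar> \<le> 1"
  obtains v where "sin v = y" "v > M"
proof -
  obtain m :: nat where "M + pi < 2 * real m * pi"
    using reals_Archimedean3[of "2 * pi"] by (auto simp: mult_ac)
  moreover have "- (pi / 2) \<le> arcsin y" using assms by (intro arcsin_lbound) auto
  ultimately have "M < arcsin y + 2 * real m * pi"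
    using pi_gt_zero by linarith
  moreover have "sin (arcsin y + 2 * real m * pi) = y"
    using assms unfolding sin_add sin_2npi cos_2npi by simp
  ultimately show thesis using that by blast
qed

lemma abs_sin_diff_le: "\<bar>sin x - sin y\<bar> \<le> \<bar>x - y\<bar>" for x y :: real
proof -
  have "\<bar>sin x - sin y\<bar> = 2 * \<bar>sin ((x - y) / 2)\<bar> * \<bar>cos ((x + y) / 2)\<bar>"
    by (simp add: sin_diff_sin abs_mult)
  also have "\<dots> \<le> 2 * \<bar>(x - y) / 2\<bar> * 1"
    by (intro mult_mono abs_sin_x_le_abs_x) auto
  finally show ?thesis by simp
qed

text \<open>Given \<open>(0, y)\<close>, choose a large \<open>v\<close> with \<open>sin v = y\<close>. The largest square root
  \<open>u = sqrt (4 + k) \<le> v\<close> satisfies \<open>v - u < 1 / v\<close> because \<open>v\<^sup>2 - u\<^sup>2 < 1\<close>, so both coordinates of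
  the point at \<open>u\<close> are within a multiple of \<open>1 / v\<close> of those of \<open>(0, y)\<close>.\<close>

lemma limit_segment_subset_closure_sqrt_points:
  "limit_segment \<subseteq> closure (sqrt_point ` {n..})"
proof
  fix p assume "p \<in> limit_segment"
  then obtain y where p: "p = (0, y)" and y: "\<bar>y\<bar> \<le> 1" by (auto simp: limit_segment_def)
  show "p \<in> closure (sqrt_point ` {n..})"
    unfolding closure_approachable
  proof (intro allI impI)
    fix e :: real assume "e > 0"
    obtain v where v: "sin v = y" and big: "v > max (real n + 4) (4 / e)"
      using sin_eq_beyond[OF y] by metis
    then have v4: "v > 4" "real n + 4 < v" "4 / e < v" by auto
    define k where "k = nat \<lfloor>v\<^sup>2 - 4\<rfloor>"
    have v2: "v\<^sup>2 \<ge> 4 * v" using v4 by (simp add: power2_eq_square)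
    then have "0 \<le> \<lfloor>v\<^sup>2 - 4\<rfloor>" using v4 by (intro zero_le_floor[THEN iffD2]) linarith
    then have "real k = real_of_int \<lfloor>v\<^sup>2 - 4\<rfloor>" unfolding k_def by (rule of_nat_nat)
    then have k: "real k \<le> v\<^sup>2 - 4" "v\<^sup>2 - 4 < real k + 1"
      using floor_correct[of "v\<^sup>2 - 4"] by (simp_all only: of_int_add of_int_1)
    have "real n < real k + 1" using v4 v2 k by linarith
    then have "n \<le> k" by linarith
    define u where "u = sqrt (4 + real k)"
    have u: "u\<^sup>2 \<le> v\<^sup>2" "v\<^sup>2 - 1 < u\<^sup>2" "0 < u" using k by (auto simp: u_def)
    have "u \<le> v" using u v4 by (simp add: power2_le_iff_abs_le)
    have "(v - u) * v \<le> (v - u) * (v + u)"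
      using \<open>u \<le> v\<close> u v4 by (intro mult_left_mono) auto
    also have "\<dots> = v\<^sup>2 - u\<^sup>2" by (simp add: algebra_simps power2_eq_square)
    finally have "(v - u) * v < 1" using u by linarith
    then have vu: "v - u < 1 / v" using v4 by (simp add: field_simps)
    have "1 / v < 1" using v4 by simp
    then have "v / 2 < u" using vu v4 by linarith
    then have "1 / u \<le> 2 / v" using v4 u by (simp add: field_simps)
    moreover have "\<bar>sin u - y\<bar> \<le> 1 / v"
      using abs_sin_diff_le[of u v] v vu \<open>u \<le> v\<close> by simp
    moreover have "dist (sqrt_point k) p \<le> \<bar>1 / u\<bar> + \<bar>sin u - y\<bar>"
      using sqrt_sum_squares_le_sum_abs[of "1 / u" "sin u - y"]
      by (simp add: sqrt_point_def p dist_Pair_Pair dist_real_def u_def)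
    moreover have "3 / v < e" using v4 \<open>e > 0\<close> by (simp add: field_simps)
    moreover have "3 / v = 2 / v + 1 / v" "\<bar>1 / u\<bar> = 1 / u" using u by auto
    ultimately have "dist (sqrt_point k) p < e" by linarith
    then show "\<exists>q\<in>sqrt_point ` {n..}. dist q p < e" using \<open>n \<le> k\<close> by auto
  qed
qed

text \<open>Used for functions built from \<open>sin (1 / x)\<close>, where continuity at \<open>0\<close> cannot come from
  composition.\<close>

lemma continuous_on_if_abs_le_abs:
  fixes f :: "real \<Rightarrow> real"
  assumes "continuous_on (S - {0}) f" and bound: "\<And>x. x \<in> S \<Longrightarrow> \<bar>f x\<bar> \<le> \<bar>x\<bar>"
  shows "continuous_on S f"
  unfolding continuous_on_eq_continuous_within
proof
  fix x assume "x \<in> S"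
  show "continuous (at x within S) f"
  proof (cases "x = 0")
    case True
    have "(f \<longlongrightarrow> 0) (at 0 within S)"
    proof (rule Lim_null_comparison)
      show "\<forall>\<^sub>F x in at 0 within S. norm (f x) \<le> \<bar>x\<bar>"
        using bound by (auto simp: eventually_at_filter)
      show "((\<lambda>x::real. \<bar>x\<bar>) \<longlongrightarrow> 0) (at 0 within S)"
        by (rule tendsto_eq_intros | simp)+
    qed
    then show ?thesis using bound[of 0] \<open>x \<in> S\<close> True by (simp add: continuous_within)
  next
    case False
    then have "continuous (at x within (S - {0})) f"
      using assms(1) \<open>x \<in> S\<close> by (simp add: continuous_on_eq_continuous_within)
    moreover have "at x within (S - {0}) = at x within S"
      using False by (intro at_within_nhd[of x "- {0}"]) auto
    ultimately show ?thesis by simp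
  qed
qed

text \<open>Multiplying the equation \<open>y = sin (1 / x)\<close> by \<open>x\<close> makes it continuous and void at \<open>x = 0\<close>,
  so the union of segment and curve is cut out by closed conditions. Conversely the segment lies
  in the closure since it consists of limits of square root points.\<close>

lemma closure_sine_curve: "closure sine_curve = limit_segment \<union> sine_curve"
proof
  have "continuous_on UNIV (\<lambda>x::real. x * sin (1 / x))"
  proof (rule continuous_on_if_abs_le_abs)
    show "\<bar>x * sin (1 / x)\<bar> \<le> \<bar>x\<bar>" for x :: real
      using mult_left_mono[of "\<bar>sin (1 / x)\<bar>" 1 "\<bar>x\<bar>"] by (simp add: abs_mult)
  qed (auto intro!: continuous_intros)
  then have cont: "continuous_on UNIV (\<lambda>p::real \<times> real. fst p * sin (1 / fst p))"
    by (rule continuous_on_compose2) (auto intro!: continuous_intros)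
  let ?C = "{p. 0 \<le> fst p} \<inter> {p. fst p \<le> 2 / pi} \<inter> {p. \<bar>snd p\<bar> \<le> 1}
    \<inter> {p::real \<times> real. fst p * snd p = fst p * sin (1 / fst p)}"
  have "closed ?C"
    by (intro closed_Int closed_Collect_le closed_Collect_eq cont continuous_intros)
  moreover have "limit_segment \<union> sine_curve = ?C"
    by (auto simp: limit_segment_def sine_curve_def)
  ultimately have "closed (limit_segment \<union> sine_curve)" by metis
  then show "closure sine_curve \<subseteq> limit_segment \<union> sine_curve"
    by (intro closure_minimal) auto
  have "closure (sqrt_point ` {0..}) \<subseteq> closure sine_curve"
    using sqrt_point_in_sine_curve by (intro closure_mono) auto
  then show "limit_segment \<union> sine_curve \<subseteq> closure sine_curve"
    using limit_segment_subset_closure_sqrt_points[of 0] closure_subset[of sine_curve] by blast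
qed

lemma path_connected_limit_segment: "path_connected limit_segment"
  unfolding limit_segment_def by (intro convex_imp_path_connected convex_Times) auto

lemma path_connected_sine_curve: "path_connected sine_curve"
proof -
  have eq: "sine_curve = (\<lambda>x. (x, sin (1 / x))) ` {0<..2 / pi}"
    by (auto simp: sine_curve_def)
  show ?thesis unfolding eq
    by (intro path_connected_continuous_image continuous_intros convex_imp_path_connected) auto
qed

text \<open>Otherwise, after its last visit to the segment, the path has positive first coordinate. By
  the intermediate value theorem that coordinate sweeps out a whole interval \<open>(0, c]\<close> in
  arbitrarily short time, so the second coordinate takes both values \<open>1\<close> and \<open>-1\<close> at times where
  continuity keeps it within distance less than \<open>1\<close> of one fixed number.\<close>

lemma path_from_limit_segment_stays_in_limit_segment:
  fixes \<gamma> :: "real \<Rightarrow> real \<times> real"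
  assumes \<gamma>: "continuous_on {0..1} \<gamma>" "\<gamma> ` {0..1} \<subseteq> closure sine_curve"
    and "\<gamma> 0 \<in> limit_segment"
  shows "\<gamma> 1 \<in> limit_segment"
proof (rule ccontr)
  assume "\<gamma> 1 \<notin> limit_segment"
  moreover have "closedin (top_of_set (closure sine_curve)) limit_segment"
    by (intro closed_subset) (auto simp: limit_segment_def closure_sine_curve intro: closed_Times)
  ultimately obtain \<beta> :: "real \<Rightarrow> real \<times> real" where \<beta>: "continuous_on {0..1} \<beta>" "\<beta> ` {0..1} \<subseteq> closure sine_curve"
    and start: "\<And>t. t \<in> {0..1} \<Longrightarrow> \<beta> t \<in> limit_segment \<longleftrightarrow> t = 0"
    using path_from_last_visit[OF \<gamma> _ assms(3)] by metis
  obtain d where "d > 0"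
    and near: "\<And>t. t \<in> {0..1} \<Longrightarrow> dist t 0 < d \<Longrightarrow> dist (\<beta> t) (\<beta> 0) < 1"
    using \<beta>(1)[unfolded continuous_on_iff, rule_format, of 0 1] by auto
  \<comment> \<open>On \<open>[0, s]\<close> the second coordinate of \<open>\<beta>\<close> stays close to its value at \<open>0\<close>.\<close>
  define s where "s = min 1 (d / 2)"
  have s: "0 < s" "s \<le> 1" "s < d" using \<open>d > 0\<close> by (auto simp: s_def)
  have on_curve: "\<beta> t \<in> sine_curve" if "0 < t" "t \<le> s" for t
  proof -
    have "t \<in> {0..1}" using that s by auto
    then have "\<beta> t \<in> limit_segment \<union> sine_curve" "\<beta> t \<notin> limit_segment"
      using \<beta>(2) start[of t] that unfolding closure_sine_curve by blast+
    then show ?thesis by blast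
  qed
  have fst0: "fst (\<beta> 0) = 0" using start[of 0] by (auto simp: limit_segment_def)
  have fst_s: "0 < fst (\<beta> s)" using on_curve[of s] s by (auto simp: sine_curve_def)
  have attained: "\<exists>t. 0 < t \<and> t \<le> s \<and> snd (\<beta> t) = y" if y: "\<bar>y\<bar> \<le> 1" for y
  proof -
    obtain v where v: "sin v = y" "v > 1 / fst (\<beta> s)" using sin_eq_beyond[OF y] by metis
    have "0 < 1 / fst (\<beta> s)" using fst_s by simp
    then have "v > 0" using v by linarith
    have "1 / v \<le> fst (\<beta> s)" using v fst_s \<open>v > 0\<close> by (simp add: field_simps)
    moreover have "continuous_on {0..s} (\<lambda>t. fst (\<beta> t))"
      using s by (intro continuous_intros continuous_on_subset[OF \<beta>(1)]) auto
    ultimately obtain t where t: "0 \<le> t" "t \<le> s" "fst (\<beta> t) = 1 / v"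
      using IVT'[of "\<lambda>t. fst (\<beta> t)" 0 "1 / v" s] fst0 s \<open>v > 0\<close> by auto
    then have "t > 0" using fst0 \<open>v > 0\<close> by (cases "t = 0") auto
    then have "snd (\<beta> t) = y" using on_curve[of t] t v by (auto simp: sine_curve_def)
    then show ?thesis using t \<open>t > 0\<close> by blast
  qed
  have close: "\<bar>snd (\<beta> t) - snd (\<beta> 0)\<bar> < 1" if "0 < t" "t \<le> s" for t
    using near[of t] that s dist_snd_le[of "\<beta> t" "\<beta> 0"] by (auto simp: dist_real_def)
  obtain t t' where "0 < t" "t \<le> s" "snd (\<beta> t) = 1" "0 < t'" "t' \<le> s" "snd (\<beta> t') = - 1"
    using attained[of 1] attained[of "- 1"] by auto
  then show False using close[of t] close[of t'] by linarith
qed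

section \<open>The limit segment as an alpha-limit set\<close>

text \<open>In the coordinate \<open>u = 1 / x\<close> this is \<open>u \<mapsto> max (pi / 2) (sqrt (u\<^sup>2 - 1))\<close>; written in \<open>x\<close>, the
  formula also makes sense at \<open>x = 0\<close>. Where the cap is not reached, \<open>u\<^sup>2\<close> drops by exactly
  \<open>1\<close>, so backward orbits are square roots of arithmetic progressions.\<close>

definition stretch :: "real \<Rightarrow> real" where
  "stretch x = min (2 / pi) (x / sqrt (1 - x\<^sup>2))"

text \<open>Adding the difference of the two sines turns the second coordinate \<open>sin (1 / x)\<close> of a point on
  the curve into that of the new point. At first coordinate \<open>0\<close> the convention \<open>1 / 0 = 0\<close> makes the
  difference vanish, so the same formula is the identity on the limit segment.\<close>

definition slide :: "real \<times> real \<Rightarrow> real \<times> real" where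
  "slide p = (stretch (fst p), snd p + (sin (1 / stretch (fst p)) - sin (1 / fst p)))"

lemma square_less_one:
  assumes "0 \<le> x" "x \<le> 2 / pi" shows "x\<^sup>2 < 1"
proof -
  have "2 / pi < 1" using pi_gt3 by simp
  then have "x < 1" using assms by linarith
  then show ?thesis using assms by (simp add: abs_square_less_1)
qed

lemma stretch_ge:
  assumes "0 \<le> x" "x \<le> 2 / pi" shows "x \<le> stretch x"
proof -
  have "x\<^sup>2 < 1" using assms by (rule square_less_one)
  then have "sqrt (1 - x\<^sup>2) \<le> 1" "0 < sqrt (1 - x\<^sup>2)" by auto
  then have "x \<le> x / sqrt (1 - x\<^sup>2)"
    using assms mult_left_mono[of "sqrt (1 - x\<^sup>2)" 1 x] by (simp add: field_simps)
  then show ?thesis using assms by (simp add: stretch_def)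
qed

lemma continuous_on_stretch: "continuous_on {0..2 / pi} stretch"
proof -
  have "sqrt (1 - x\<^sup>2) \<noteq> 0" if "x \<in> {0..2 / pi}" for x
    using square_less_one[of x] that by auto
  then show ?thesis unfolding stretch_def by (intro continuous_intros) auto
qed

text \<open>The uncapped displacement of \<open>u = 1 / x\<close> is \<open>(1 - sqrt (1 - x\<^sup>2)) / x\<close>, and \<open>sqrt z \<ge> z\<close> on
  \<open>[0,1]\<close> bounds it by \<open>x\<close>. This is what makes the slide continuous at the limit segment.\<close>

lemma inverse_stretch_close:
  assumes "0 < x" "x \<le> 2 / pi" shows "\<bar>1 / stretch x - 1 / x\<bar> \<le> x"
proof -
  have ge: "x \<le> stretch x" using assms by (intro stretch_ge) auto
  have x2: "x\<^sup>2 < 1" using assms by (intro square_less_one) auto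
  define r where "r = sqrt (1 - x\<^sup>2)"
  have r: "0 < r" "r \<le> 1" "r\<^sup>2 = 1 - x\<^sup>2" using x2 by (auto simp: r_def)
  have "r\<^sup>2 \<le> r" using r(1,2) by (simp add: power2_eq_square mult_left_le)
  then have "1 - r \<le> x * x" using r(3) unfolding power2_eq_square by linarith
  then have "1 / x - r / x \<le> x" using assms by (simp add: field_simps)
  moreover have "r / x \<le> 1 / stretch x"
  proof -
    have "stretch x \<le> x / r" by (simp add: stretch_def r_def)
    then have "1 / (x / r) \<le> 1 / stretch x"
      using ge assms r by (intro divide_left_mono) auto
    then show ?thesis by simp
  qed
  moreover have "1 / stretch x \<le> 1 / x" using ge assms by (intro divide_left_mono) auto
  ultimately show ?thesis by linarith
qed

text \<open>The cap at \<open>2 / pi\<close> identifies many points, but its value is never of the form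
  \<open>1 / sqrt (4 + k)\<close>, so it does not interfere with the preimages considered here.\<close>

lemma stretch_eq_iff:
  assumes "0 \<le> x" "x \<le> 2 / pi"
  shows "stretch x = 1 / sqrt (4 + real k) \<longleftrightarrow> x = 1 / sqrt (4 + real (Suc k))"
proof -
  define q where "q = 1 / sqrt (4 + real k)"
  have x2: "x\<^sup>2 < 1" using assms by (intro square_less_one) auto
  have "q < 2 / pi"
    using inverse_sqrt_less_two_div_pi[of k] by (simp add: q_def)
  then have "stretch x = q \<longleftrightarrow> x / sqrt (1 - x\<^sup>2) = q"
    by (auto simp: stretch_def min_def)
  also have "\<dots> \<longleftrightarrow> (x / sqrt (1 - x\<^sup>2))\<^sup>2 = q\<^sup>2"
    using assms x2 by (intro power2_eq_iff_nonneg[symmetric]) (auto simp: q_def)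
  also have "\<dots> \<longleftrightarrow> x\<^sup>2 / (1 - x\<^sup>2) = 1 / (4 + real k)"
    using x2 by (simp add: q_def power_divide)
  also have "\<dots> \<longleftrightarrow> x\<^sup>2 = 1 / (5 + real k)"
    using x2 by (auto simp: field_simps)
  also have "\<dots> \<longleftrightarrow> x\<^sup>2 = (1 / sqrt (5 + real k))\<^sup>2"
    by (simp add: power_divide)
  also have "\<dots> \<longleftrightarrow> x = 1 / sqrt (5 + real k)"
    using assms by (intro power2_eq_iff_nonneg) auto
  finally show ?thesis by (simp add: q_def)
qed

lemma fst_closure_sine_curve:
  "p \<in> closure sine_curve \<Longrightarrow> 0 \<le> fst p \<and> fst p \<le> 2 / pi"
  unfolding closure_sine_curve by (auto simp: limit_segment_def sine_curve_def)

lemma slide_in: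
  assumes "p \<in> closure sine_curve" shows "slide p \<in> closure sine_curve"
  using assms unfolding closure_sine_curve
proof
  assume "p \<in> limit_segment"
  then have "slide p = p" by (auto simp: slide_def stretch_def limit_segment_def)
  then show "slide p \<in> limit_segment \<union> sine_curve" using \<open>p \<in> limit_segment\<close> by simp
next
  assume "p \<in> sine_curve"
  then obtain x where x: "p = (x, sin (1 / x))" "0 < x" "x \<le> 2 / pi"
    by (auto simp: sine_curve_def)
  then have "0 < stretch x" using stretch_ge[of x] by linarith
  then show "slide p \<in> limit_segment \<union> sine_curve"
    by (auto simp: slide_def x sine_curve_def stretch_def)
qed

lemma continuous_on_slide: "continuous_on (closure sine_curve) slide"
proof -
  define d where "d = (\<lambda>x. sin (1 / stretch x) - sin (1 / x))"
  have "continuous_on {0..2 / pi} d"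
  proof (rule continuous_on_if_abs_le_abs)
    have "stretch x \<noteq> 0" if "x \<in> {0..2 / pi} - {0}" for x
      using stretch_ge[of x] that by auto
    then show "continuous_on ({0..2 / pi} - {0}) d" unfolding d_def
      by (intro continuous_intros continuous_on_subset[OF continuous_on_stretch]) auto
    show "\<bar>d x\<bar> \<le> \<bar>x\<bar>" if "x \<in> {0..2 / pi}" for x
    proof (cases "x = 0")
      case False
      then show ?thesis
        using that inverse_stretch_close[of x] abs_sin_diff_le[of "1 / stretch x" "1 / x"]
        by (auto simp: d_def)
    qed (simp add: d_def stretch_def)
  qed
  then have "continuous_on (closure sine_curve) (\<lambda>p. d (fst p))"
    by (rule continuous_on_compose2)
      (use fst_closure_sine_curve in \<open>auto intro!: continuous_intros\<close>)
  moreover have "continuous_on (closure sine_curve) (\<lambda>p. stretch (fst p))"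
    by (rule continuous_on_compose2[OF continuous_on_stretch])
      (use fst_closure_sine_curve in \<open>auto intro!: continuous_intros\<close>)
  ultimately have "continuous_on (closure sine_curve) (\<lambda>p. (stretch (fst p), snd p + d (fst p)))"
    by (intro continuous_intros)
  then show ?thesis unfolding slide_def d_def .
qed

text \<open>A point with positive first coordinate is determined by that coordinate, so the preimage
  can be computed from \<open>stretch\<close> alone.\<close>

lemma slide_eq_sqrt_point_iff:
  assumes "p \<in> closure sine_curve"
  shows "slide p = sqrt_point k \<longleftrightarrow> p = sqrt_point (Suc k)"
proof -
  have on_curve: "q = (fst q, sin (1 / fst q))" if "q \<in> closure sine_curve" "fst q > 0" for q
    using that unfolding closure_sine_curve by (auto simp: limit_segment_def sine_curve_def)
  have determined: "q = sqrt_point j \<longleftrightarrow> fst q = 1 / sqrt (4 + real j)"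
    if "q \<in> closure sine_curve" for q j
  proof
    assume eq: "fst q = 1 / sqrt (4 + real j)"
    then have "0 < fst q" by simp
    then have "q = (fst q, sin (1 / fst q))" using on_curve that by blast
    then show "q = sqrt_point j" unfolding sqrt_point_def eq by simp
  qed (simp add: sqrt_point_def)
  show ?thesis
    using determined[OF slide_in[OF assms]] determined[OF assms] fst_closure_sine_curve[OF assms]
      stretch_eq_iff[of "fst p" k]
    by (simp add: slide_def)
qed

text \<open>The \<open>k\<close>-th preimage is the \<open>k\<close>-th square root point. The tails of this sequence have the whole
  segment in their closures, and their first coordinates tend to \<open>0\<close>.\<close>

lemma alpha_limit_slide:
  "alpha_limit closed_sine_curve slide (sqrt_point 0) = limit_segment"
proof -
  let ?T = "closure sine_curve"
  have iter: "(slide ^^ k) p = sqrt_point 0 \<longleftrightarrow> p = sqrt_point k" if "p \<in> ?T" for k p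
    using that
  proof (induction k arbitrary: p)
    case (Suc k)
    then show ?case
      using Suc.IH[OF slide_in] slide_eq_sqrt_point_iff
      by (simp add: funpow_Suc_right del: funpow.simps)
  qed simp
  have in_T: "sqrt_point k \<in> ?T" for k
    using sqrt_point_in_sine_curve closure_subset by blast
  have "{p \<in> ?T. (slide ^^ k) p = sqrt_point 0} = {sqrt_point k}" for k
    using in_T by (auto simp: iter)
  then have "(\<Union>k\<in>{n..}. {p \<in> ?T. (slide ^^ k) p = sqrt_point 0}) = sqrt_point ` {n..}" for n
    by auto
  then have limit: "alpha_limit closed_sine_curve slide (sqrt_point 0)
      = (\<Inter>n. ?T \<inter> closure (?T \<inter> sqrt_point ` {n..}))"
    by (simp add: alpha_limit_def closed_sine_curve_def closure_of_subtopology)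
  have "?T \<inter> sqrt_point ` {n..} = sqrt_point ` {n..}" for n using in_T by auto
  with limit have limit': "alpha_limit closed_sine_curve slide (sqrt_point 0)
      = (\<Inter>n. ?T \<inter> closure (sqrt_point ` {n..}))" by simp
  show ?thesis
  proof
    show "limit_segment \<subseteq> alpha_limit closed_sine_curve slide (sqrt_point 0)"
      unfolding limit' using limit_segment_subset_closure_sqrt_points
      by (auto simp: closure_sine_curve)
    show "alpha_limit closed_sine_curve slide (sqrt_point 0) \<subseteq> limit_segment"
    proof
      fix p assume "p \<in> alpha_limit closed_sine_curve slide (sqrt_point 0)"
      then have p: "p \<in> ?T" "p \<in> closure (sqrt_point ` {n..})" for n by (auto simp: limit')
      have "fst p \<le> 1 / sqrt (4 + real n)" for n
      proof -
        have "closure (sqrt_point ` {n..}) \<subseteq> {q. fst q \<le> 1 / sqrt (4 + real n)}"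
          by (intro closure_minimal closed_Collect_le continuous_intros)
            (auto simp: sqrt_point_def intro!: divide_left_mono)
        then show ?thesis using p(2) by blast
      qed
      moreover have "(\<lambda>n. 1 / sqrt (4 + real n)) \<longlonglongrightarrow> 0"
        by (intro tendsto_divide_0[OF tendsto_const] filterlim_at_top_imp_at_infinity
            filterlim_compose[OF sqrt_at_top]
            filterlim_tendsto_add_at_top[OF tendsto_const] filterlim_real_sequentially)
      ultimately have "fst p \<le> 0" by (intro LIMSEQ_le_const) auto
      then show "p \<in> limit_segment"
        using p(1) unfolding closure_sine_curve by (auto simp: sine_curve_def)
    qed
  qed
qed

section \<open>Closed sets and arcs in the closed sine curve\<close>

lemma topspace_closed_sine_curve: "topspace closed_sine_curve = limit_segment \<union> sine_curve"
  by (simp add: closed_sine_curve_def closure_sine_curve)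

text \<open>The five cases exhaust the closed sets: if neither piece is cut by \<open>A\<close>, then \<open>A\<close> is a union
  of pieces, and containing the dense piece \<open>sine_curve\<close> means being everything.\<close>

lemma AF_property_closed_sine_curve: "AF_property closed_sine_curve"
  unfolding AF_property_def
proof (intro conjI allI iffI)
  show "metrizable_space closed_sine_curve"
    unfolding closed_sine_curve_def
    by (intro metrizable_space_subtopology metrizable_space_euclidean)
  fix A
  show "closedin closed_sine_curve A" if "alpha_limit_set_in closed_sine_curve A"
    using that closedin_alpha_limit unfolding alpha_limit_set_in_def by metis
  assume closed: "closedin closed_sine_curve A"
  then have A: "closedin (top_of_set (closure sine_curve)) A"
    by (simp add: closed_sine_curve_def)
  have AT: "A \<subseteq> limit_segment \<union> sine_curve"
    using closedin_subset[OF closed] topspace_closed_sine_curve by simp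
  have split: "alpha_limit_set_in closed_sine_curve A"
    if "path_connected P" "P \<subseteq> limit_segment \<union> sine_curve" "P \<inter> A \<noteq> {}" "P - A \<noteq> {}" for P
    using alpha_limit_set_in_if_separates_path_connected[OF A that(1)] that
    by (simp add: closed_sine_curve_def closure_sine_curve)
  consider "sine_curve \<subseteq> A"
    | "limit_segment \<inter> A \<noteq> {}" "limit_segment - A \<noteq> {}"
    | "sine_curve \<inter> A \<noteq> {}" "sine_curve - A \<noteq> {}"
    | "A = {}" | "A = limit_segment"
    using AT by blast
  then show "alpha_limit_set_in closed_sine_curve A"
  proof cases
    case 1
    have "closed A" using A closedin_closed_eq by blast
    then have "closure sine_curve \<subseteq> A" using 1 by (simp add: closure_minimal)
    then have "A = topspace closed_sine_curve"
      using AT topspace_closed_sine_curve closure_sine_curve by auto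
    then show ?thesis
      using alpha_limit_set_in_topspace[of closed_sine_curve] sqrt_point_in_sine_curve[of 0]
        topspace_closed_sine_curve by blast
  next
    case 2
    then show ?thesis using split path_connected_limit_segment by blast
  next
    case 3
    then show ?thesis using split path_connected_sine_curve by blast
  next
    case 4
    have "(0, 0) \<in> topspace closed_sine_curve" "(0, 1) \<in> topspace closed_sine_curve"
      by (auto simp: topspace_closed_sine_curve limit_segment_def)
    then show ?thesis using alpha_limit_set_in_empty 4 by fastforce
  next
    case 5
    have "continuous_map closed_sine_curve closed_sine_curve slide"
      using continuous_on_slide slide_in by (auto simp: closed_sine_curve_def)
    then show ?thesis
      using 5 alpha_limit_slide sqrt_point_in_sine_curve topspace_closed_sine_curve
      unfolding alpha_limit_set_in_def by blast
  qed
qed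

lemma not_enough_arcs_closed_sine_curve: "\<not> enough_arcs closed_sine_curve"
proof
  assume "enough_arcs closed_sine_curve"
  moreover have "closedin closed_sine_curve limit_segment"
    using closedin_alpha_limit[of closed_sine_curve slide "sqrt_point 0"]
    by (simp add: alpha_limit_slide)
  moreover have "limit_segment \<noteq> {}" by (simp add: limit_segment_def)
  moreover have "limit_segment \<noteq> topspace closed_sine_curve"
  proof -
    have "sqrt_point 0 \<notin> limit_segment" by (simp add: sqrt_point_def limit_segment_def)
    then show ?thesis using sqrt_point_in_sine_curve[of 0] topspace_closed_sine_curve by auto
  qed
  ultimately obtain C a b where "a \<in> limit_segment" "b \<notin> limit_segment"
    and arc: "arc_with_endpoints closed_sine_curve C a b"
    unfolding enough_arcs_def by blast
  from arc obtain h where C: "C \<subseteq> topspace closed_sine_curve" and "h 0 = a" "h 1 = b"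
    and "homeomorphic_map (top_of_set {0..1::real}) (subtopology closed_sine_curve C) h"
    unfolding arc_with_endpoints_def by blast
  then have "continuous_map (top_of_set {0..1::real}) (subtopology closed_sine_curve C) h"
    by (blast intro: homeomorphic_imp_continuous_map)
  then have "continuous_map (top_of_set {0..1::real}) (top_of_set (closure sine_curve)) h"
    unfolding closed_sine_curve_def by (rule continuous_map_into_fulltopology)
  then have "continuous_on {0..1} h" "h ` {0..1} \<subseteq> closure sine_curve" by auto
  then have "b \<in> limit_segment"
    using path_from_limit_segment_stays_in_limit_segment \<open>a \<in> limit_segment\<close> \<open>h 0 = a\<close> \<open>h 1 = b\<close>
    by blast
  then show False using \<open>b \<notin> limit_segment\<close> by simp
qed

theorem lemma12:
  shows "AF_property closed_sine_curve \<and> \<not> enough_arcs closed_sine_curve"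
  using AF_property_closed_sine_curve not_enough_arcs_closed_sine_curve by blast

end
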